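(* Let $\pi\colon(X,T)\to(Y,S)$ be a factor map between two dynamical systems. If $(X,T)$ is mean equicontinuous, then so is $(Y,S)$.
   Context: A dynamical system $(X,T)$ is a compact metric space $(X,d)$ together with a continuous map $T\colon X\to X$; the metric on any system is denoted $d$. $(X,T)$ is mean equicontinuous if for every $\varepsilon>0$ there is $\delta>0$ such that for all $x,y\in X$ with $d(x,y)<\delta$, $\limsup_{n\to\infty}\frac1n\sum_{i=0}^{n-1}d(T^ix,T^iy)<\varepsilon$. A factor map $\pi\colon(X,T)\to(Y,S)$ is a continuous surjection $\pi\colon X\to Y$ with $\pi\circ T=S\circ\pi$. *)

theory Defs
  imports "HOL-Analysis.Analysis"
begin

text \<open>A compact metric space is a compact subset \<open>X\<close> of a type of class \<^class>\<open>metric_space\<close>,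
  with the restriction of \<^const>\<open>dist\<close> as its metric; maps on it matter only through their values on \<open>X\<close>.
  The empty system is not excluded.\<close>

definition dynamical_system :: "'a::metric_space set \<Rightarrow> ('a \<Rightarrow> 'a) \<Rightarrow> bool" where
  "dynamical_system X T \<longleftrightarrow> compact X \<and> continuous_on X T \<and> T ` X \<subseteq> X"

text \<open>The limes superior is taken in \<^typ>\<open>ereal\<close>; the term at \<open>n = 0\<close> is irrelevant to it.\<close>

definition mean_equicontinuous :: "'a::metric_space set \<Rightarrow> ('a \<Rightarrow> 'a) \<Rightarrow> bool" where
  "mean_equicontinuous X T \<longleftrightarrow>
    (\<forall>\<epsilon>::real. \<epsilon> > 0 \<longrightarrow> (\<exists>\<delta>::real. \<delta> > 0 \<and> (\<forall>x\<in>X. \<forall>y\<in>X. dist x y < \<delta> \<longrightarrow>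
      limsup (\<lambda>n. ereal (1 / real n * (\<Sum>i<n. dist ((T ^^ i) x) ((T ^^ i) y)))) < ereal \<epsilon>)))"

definition factor_map ::
  "'a::metric_space set \<Rightarrow> ('a \<Rightarrow> 'a) \<Rightarrow> 'b::metric_space set \<Rightarrow> ('b \<Rightarrow> 'b) \<Rightarrow> ('a \<Rightarrow> 'b) \<Rightarrow> bool" where
  "factor_map X T Y S \<pi> \<longleftrightarrow>
    continuous_on X \<pi> \<and> \<pi> ` X = Y \<and> (\<forall>x\<in>X. \<pi> (T x) = S (\<pi> x))"

end

theory Submission
  imports Defs
begin

text \<open>A uniformly continuous \<open>\<pi>\<close> into a bounded space satisfies
  \<open>d(\<pi> a, \<pi> b) \<le> \<eta> + C d(a, b)\<close> with \<open>C\<close> depending on \<open>\<eta>\<close>, and this inequality survives averaging along orbits.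
  So points that are close in \<open>X\<close> have images that stay close on average. Two close points of \<open>Y\<close> need
  not have close preimages, but if their mean distance did not tend to 0 with their distance, then by
  compactness one could choose preimages \<open>u\<^sub>n \<rightarrow> a\<close> and \<open>v\<^sub>n \<rightarrow> b\<close>, where \<open>\<pi> a = \<pi> b\<close>;
  the triangle inequality through \<open>\<pi> a = \<pi> b\<close> gives a contradiction.\<close>

definition mean_dist :: "('a::metric_space \<Rightarrow> 'a) \<Rightarrow> nat \<Rightarrow> 'a \<Rightarrow> 'a \<Rightarrow> real" where
  "mean_dist T n x y = 1 / real n * (\<Sum>i<n. dist ((T ^^ i) x) ((T ^^ i) y))"

lemma mean_dist_commute: "mean_dist T n x y = mean_dist T n y x"
  by (simp add: mean_dist_def dist_commute)

lemma mean_dist_triangle: "mean_dist T n x z \<le> mean_dist T n x y + mean_dist T n y z"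
proof -
  have "(\<Sum>i<n. dist ((T ^^ i) x) ((T ^^ i) z))
      \<le> (\<Sum>i<n. dist ((T ^^ i) x) ((T ^^ i) y)) + (\<Sum>i<n. dist ((T ^^ i) y) ((T ^^ i) z))"
    unfolding sum.distrib [symmetric] by (intro sum_mono dist_triangle)
  from mult_left_mono [OF this, of "1 / real n"] show ?thesis
    by (simp add: mean_dist_def algebra_simps)
qed

text \<open>Trades the limsup in \<open>ereal\<close> for eventual bounds on real averages, which
  can be combined for each \<open>n\<close> separately. An eventual strict bound survives in the
  limsup only as a non-strict one, so the converse takes the \<delta> belonging to
  \<open>\<epsilon> / 2\<close>.\<close>

lemma mean_equicontinuous_iff_eventually:
  "mean_equicontinuous X T \<longleftrightarrow>
    (\<forall>\<epsilon>>0. \<exists>\<delta>>0. \<forall>x\<in>X. \<forall>y\<in>X. dist x y < \<delta> \<longrightarrow> (\<forall>\<^sub>F n in sequentially. mean_dist T n x y < \<epsilon>))"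
  (is "_ \<longleftrightarrow> ?rhs")
proof
  assume "mean_equicontinuous X T"
  then show ?rhs
    unfolding mean_equicontinuous_def mean_dist_def [symmetric]
    by (force dest: Limsup_lessD)
next
  assume R: ?rhs
  show "mean_equicontinuous X T"
    unfolding mean_equicontinuous_def mean_dist_def [symmetric]
  proof (intro allI impI)
    fix \<epsilon> :: real assume "\<epsilon> > 0"
    then obtain \<delta> where "\<delta> > 0" and \<delta>: "\<And>x y. \<lbrakk>x \<in> X; y \<in> X; dist x y < \<delta>\<rbrakk> \<Longrightarrow>
        \<forall>\<^sub>F n in sequentially. mean_dist T n x y < \<epsilon> / 2"
      using R by (meson half_gt_zero)
    have "limsup (\<lambda>n. ereal (mean_dist T n x y)) < ereal \<epsilon>"
      if "x \<in> X" "y \<in> X" "dist x y < \<delta>" for x y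
    proof -
      have "limsup (\<lambda>n. ereal (mean_dist T n x y)) \<le> ereal (\<epsilon> / 2)"
        using \<delta> [OF that] by (intro Limsup_bounded) (auto elim: eventually_mono)
      also have "\<dots> < ereal \<epsilon>" using \<open>\<epsilon> > 0\<close> by simp
      finally show ?thesis .
    qed
    with \<open>\<delta> > 0\<close> show "\<exists>\<delta>>0. \<forall>x\<in>X. \<forall>y\<in>X. dist x y < \<delta> \<longrightarrow>
        limsup (\<lambda>n. ereal (mean_dist T n x y)) < ereal \<epsilon>"
      by blast
  qed
qed

text \<open>Uniform continuity makes the constant \<eta> suffice for pairs closer than some
  \<open>d\<close>. For all other pairs \<open>C * dist a b\<close> is at least
  \<open>C * d\<close>, which is chosen to exceed any distance between image points.\<close>

lemma uniformly_continuous_on_dist_affine_bound: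
  fixes f :: "'a::metric_space \<Rightarrow> 'b::metric_space"
  assumes "uniformly_continuous_on X f" "bounded (f ` X)" "\<eta> > 0"
  obtains C where "C > 0" "\<And>a b. \<lbrakk>a \<in> X; b \<in> X\<rbrakk> \<Longrightarrow> dist (f a) (f b) \<le> \<eta> + C * dist a b"
proof -
  obtain d where "d > 0" and d: "\<And>a b. \<lbrakk>a \<in> X; b \<in> X; dist b a < d\<rbrakk> \<Longrightarrow> dist (f b) (f a) < \<eta>"
    using assms(1,3) unfolding uniformly_continuous_on_def by metis
  obtain M where M: "\<And>a b. \<lbrakk>a \<in> X; b \<in> X\<rbrakk> \<Longrightarrow> dist (f a) (f b) \<le> M"
    using assms(2) unfolding bounded_two_points by auto
  \<comment> \<open>The maximum with 1 keeps \<open>C\<close> positive even when \<open>M\<close> is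
    not.\<close>
  define C where "C = max 1 M / d"
  have "C > 0" using \<open>d > 0\<close> by (simp add: C_def)
  moreover have "dist (f a) (f b) \<le> \<eta> + C * dist a b" if "a \<in> X" "b \<in> X" for a b
  proof (cases "dist a b < d")
    case True
    then have "dist (f a) (f b) < \<eta>" using d that by blast
    moreover have "0 \<le> C * dist a b" using \<open>C > 0\<close> by simp
    ultimately show ?thesis by linarith
  next
    case False
    have "max 1 M = C * d" using \<open>d > 0\<close> by (simp add: C_def)
    also have "\<dots> \<le> C * dist a b" using False \<open>C > 0\<close> by (intro mult_left_mono) auto
    finally show ?thesis using M [OF that] \<open>\<eta> > 0\<close> by linarith
  qed
  ultimately show thesis by (rule that)
qed

lemma funpow_mem: "T ` X \<subseteq> X \<Longrightarrow> x \<in> X \<Longrightarrow> (T ^^ i) x \<in> X"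
  by (induction i) auto

lemma factor_map_funpow:
  assumes "factor_map X T Y S \<pi>" "T ` X \<subseteq> X" "x \<in> X"
  shows "(S ^^ i) (\<pi> x) = \<pi> ((T ^^ i) x)"
  by (induction i) (use assms funpow_mem [OF assms(2,3)] in \<open>auto simp: factor_map_def\<close>)

text \<open>By the semiconjugacy the \<open>S\<close>-orbit of \<open>\<pi> x\<close> is the image
  of the \<open>T\<close>-orbit of \<open>x\<close>, so \<open>bound\<close> applies at every time
  \<open>i\<close>. Being affine in the distance, it passes to averages with the same
  constants.\<close>

lemma mean_dist_factor_le:
  assumes \<pi>: "factor_map X T Y S \<pi>" and T: "T ` X \<subseteq> X"
    and bound: "\<And>a b. \<lbrakk>a \<in> X; b \<in> X\<rbrakk> \<Longrightarrow> dist (\<pi> a) (\<pi> b) \<le> \<eta> + C * dist a b"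
    and "\<eta> \<ge> 0" "x \<in> X" "y \<in> X"
  shows "mean_dist S n (\<pi> x) (\<pi> y) \<le> \<eta> + C * mean_dist T n x y"
\<comment> \<open>Averaging the constant \<eta> returns \<eta> only for positive \<open>n\<close>.
  At \<open>n = 0\<close> both means are 0 because \<open>1 / 0 = 0\<close>, and the claim is just
  \<open>0 \<le> \<eta>\<close>.\<close>
proof (cases "n = 0")
  case True
  then show ?thesis using \<open>\<eta> \<ge> 0\<close> by (simp add: mean_dist_def)
next
  case False
  have "(\<Sum>i<n. dist ((S ^^ i) (\<pi> x)) ((S ^^ i) (\<pi> y)))
      \<le> (\<Sum>i<n. \<eta> + C * dist ((T ^^ i) x) ((T ^^ i) y))"
    using assms by (intro sum_mono) (simp add: factor_map_funpow [OF \<pi> T] funpow_mem [OF T])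
  also have "\<dots> = real n * \<eta> + C * (\<Sum>i<n. dist ((T ^^ i) x) ((T ^^ i) y))"
    by (simp add: sum.distrib sum_distrib_left)
  finally show ?thesis
    using False by (simp add: mean_dist_def field_simps)
qed

lemma mean_equicontinuous_factor_preimages:
  assumes X: "dynamical_system X T" and \<pi>: "factor_map X T Y S \<pi>"
    and "mean_equicontinuous X T" "\<epsilon> > 0"
  obtains \<delta> where "\<delta> > 0" "\<And>x y. \<lbrakk>x \<in> X; y \<in> X; dist x y < \<delta>\<rbrakk> \<Longrightarrow>
    \<forall>\<^sub>F n in sequentially. mean_dist S n (\<pi> x) (\<pi> y) < \<epsilon>"
proof -
  have T: "T ` X \<subseteq> X" and "uniformly_continuous_on X \<pi>" "bounded (\<pi> ` X)"
    using X \<pi> by (auto simp: dynamical_system_def factor_map_def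
      intro: compact_uniformly_continuous compact_imp_bounded compact_continuous_image)
  then obtain C where "C > 0"
    and C: "\<And>a b. \<lbrakk>a \<in> X; b \<in> X\<rbrakk> \<Longrightarrow> dist (\<pi> a) (\<pi> b) \<le> \<epsilon> / 2 + C * dist a b"
    using uniformly_continuous_on_dist_affine_bound half_gt_zero [OF \<open>\<epsilon> > 0\<close>] by blast
  \<comment> \<open>Half of \<epsilon> is spent on the additive constant; a mean distance below this
    value keeps the term multiplied by \<open>C\<close> under the other half.\<close>
  have "\<epsilon> / (2 * C) > 0" using \<open>\<epsilon> > 0\<close> \<open>C > 0\<close> by simp
  then obtain \<delta> where "\<delta> > 0" and \<delta>: "\<And>x y. \<lbrakk>x \<in> X; y \<in> X; dist x y < \<delta>\<rbrakk> \<Longrightarrow>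
      \<forall>\<^sub>F n in sequentially. mean_dist T n x y < \<epsilon> / (2 * C)"
    using assms(3) unfolding mean_equicontinuous_iff_eventually by meson
  have "\<forall>\<^sub>F n in sequentially. mean_dist S n (\<pi> x) (\<pi> y) < \<epsilon>"
    if xy: "x \<in> X" "y \<in> X" "dist x y < \<delta>" for x y
    using \<delta> [OF xy]
  proof eventually_elim
    case (elim n)
    have "mean_dist S n (\<pi> x) (\<pi> y) \<le> \<epsilon> / 2 + C * mean_dist T n x y"
      using \<open>\<epsilon> > 0\<close> xy by (intro mean_dist_factor_le [OF \<pi> T C]) auto
    moreover have "C * mean_dist T n x y < \<epsilon> / 2"
      using elim \<open>C > 0\<close> by (simp add: field_simps)
    ultimately show ?case by linarith
  qed
  with \<open>\<delta> > 0\<close> show thesis by (rule that)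
qed

theorem theorem3p11:
  fixes X :: "'a::metric_space set" and T :: "'a \<Rightarrow> 'a"
    and Y :: "'b::metric_space set" and S :: "'b \<Rightarrow> 'b"
    and \<pi> :: "'a \<Rightarrow> 'b"
  assumes "dynamical_system X T"
    and "dynamical_system Y S"
    and "factor_map X T Y S \<pi>"
    and "mean_equicontinuous X T"
  shows "mean_equicontinuous Y S"
  unfolding mean_equicontinuous_iff_eventually
proof (intro allI impI, rule ccontr)
  fix \<epsilon> :: real assume "\<epsilon> > 0"
  let ?close = "\<lambda>\<epsilon> y z. \<forall>\<^sub>F n in sequentially. mean_dist S n y z < \<epsilon>"
  assume "\<not> (\<exists>\<delta>>0. \<forall>y\<in>Y. \<forall>z\<in>Y. dist y z < \<delta> \<longrightarrow> ?close \<epsilon> y z)"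
  then have neg: "\<And>\<delta>. \<delta> > 0 \<Longrightarrow> \<exists>y\<in>Y. \<exists>z\<in>Y. dist y z < \<delta> \<and> \<not> ?close \<epsilon> y z"
    by blast
  have X: "compact X" and \<pi>: "continuous_on X \<pi>" "\<pi> ` X = Y"
    using assms by (auto simp: dynamical_system_def factor_map_def)
  have "\<exists>u\<in>X. \<exists>v\<in>X. dist (\<pi> u) (\<pi> v) < inverse (real (Suc k)) \<and> \<not> ?close \<epsilon> (\<pi> u) (\<pi> v)" for k
    using neg [of "inverse (real (Suc k))"] \<pi>(2) by auto
  then obtain u v where uv: "\<And>k. u k \<in> X" "\<And>k. v k \<in> X"
      "\<And>k. dist (\<pi> (u k)) (\<pi> (v k)) < inverse (real (Suc k))"
      "\<And>k. \<not> ?close \<epsilon> (\<pi> (u k)) (\<pi> (v k))"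
    by metis
  \<comment> \<open>Compactness of the product yields one subsequence along which both preimage
    sequences converge.\<close>
  have "seq_compact (X \<times> X)"
    using X by (simp add: compact_Times flip: compact_eq_seq_compact_metric)
  then obtain p r where "p \<in> X \<times> X" "strict_mono (r :: nat \<Rightarrow> nat)"
    and lim: "((\<lambda>k. (u k, v k)) \<circ> r) \<longlonglongrightarrow> p"
    using uv(1,2) by (elim seq_compactE [of _ "\<lambda>k. (u k, v k)"]) auto
  obtain a b where p: "p = (a, b)" by (cases p)
  have ab: "a \<in> X" "b \<in> X" using \<open>p \<in> X \<times> X\<close> p by auto
  have ulim: "(\<lambda>k. u (r k)) \<longlonglongrightarrow> a" and vlim: "(\<lambda>k. v (r k)) \<longlonglongrightarrow> b"
    using tendsto_fst [OF lim] tendsto_snd [OF lim] by (simp_all add: p o_def)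
  have "(\<lambda>k. dist (\<pi> (u (r k))) (\<pi> (v (r k)))) \<longlonglongrightarrow> dist (\<pi> a) (\<pi> b)"
    using ulim vlim ab uv(1,2)
    by (intro tendsto_dist continuous_on_tendsto_compose [OF \<pi>(1)]) auto
  moreover have "(\<lambda>k. dist (\<pi> (u (r k))) (\<pi> (v (r k)))) \<longlonglongrightarrow> 0"
  proof (rule tendsto_sandwich [OF _ _ tendsto_const])
    show "(\<lambda>k. inverse (real (Suc (r k)))) \<longlonglongrightarrow> 0"
      using LIMSEQ_subseq_LIMSEQ [OF LIMSEQ_inverse_real_of_nat \<open>strict_mono r\<close>]
      by (simp add: o_def)
    show "\<forall>\<^sub>F k in sequentially. dist (\<pi> (u (r k))) (\<pi> (v (r k))) \<le> inverse (real (Suc (r k)))"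
      by (intro always_eventually allI less_imp_le uv(3))
  qed simp
  ultimately have "\<pi> a = \<pi> b"
    using LIMSEQ_unique by fastforce
  \<comment> \<open>The path from \<open>\<pi> (u (r k))\<close> to \<open>\<pi> (v (r k))\<close>
    through \<open>\<pi> a\<close> has two legs, each allowed \<open>\<epsilon> / 2\<close>.\<close>
  obtain \<delta> where "\<delta> > 0" and \<delta>: "\<And>x y. \<lbrakk>x \<in> X; y \<in> X; dist x y < \<delta>\<rbrakk> \<Longrightarrow> ?close (\<epsilon> / 2) (\<pi> x) (\<pi> y)"
    using mean_equicontinuous_factor_preimages [OF assms(1,3,4) half_gt_zero [OF \<open>\<epsilon> > 0\<close>]] by blast
  have "\<forall>\<^sub>F k in sequentially. dist (u (r k)) a < \<delta> \<and> dist (v (r k)) b < \<delta>"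
    using tendstoD [OF ulim \<open>\<delta> > 0\<close>] tendstoD [OF vlim \<open>\<delta> > 0\<close>] by (rule eventually_conj)
  \<comment> \<open>A single such \<open>k\<close> is enough: it is fixed before \<open>n\<close>
    tends to infinity, so no uniformity in \<open>k\<close> is required.\<close>
  then obtain k where "dist (u (r k)) a < \<delta>" "dist (v (r k)) b < \<delta>"
    using eventually_happens' [OF sequentially_bot] by blast
  \<comment> \<open>The second leg comes from \<open>v (r k)\<close> being near \<open>b\<close>; it
    ends at \<open>\<pi> b\<close>, which is the same point as \<open>\<pi> a\<close>.\<close>
  then have "?close (\<epsilon> / 2) (\<pi> (u (r k))) (\<pi> a)" "?close (\<epsilon> / 2) (\<pi> (v (r k))) (\<pi> a)"
    using \<delta> uv(1,2) ab \<open>\<pi> a = \<pi> b\<close> by metis+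
  then have "?close \<epsilon> (\<pi> (u (r k))) (\<pi> (v (r k)))"
  proof eventually_elim
    case (elim n)
    then show ?case
      using mean_dist_triangle [of S n "\<pi> (u (r k))" "\<pi> (v (r k))" "\<pi> a"]
        mean_dist_commute [of S n "\<pi> a" "\<pi> (v (r k))"] by linarith
  qed
  with uv(4) show False by blast
qed

end
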